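(* Let $\pi$ be a factor code from an irreducible shift of finite type $X$ onto a sofic shift $Y$. Then the following are equivalent: $\pi$ is right class-closing; $\pi$ separates right classes; $[x]^l\subset[x]^r$ for all $x\in X$. Also, $\pi$ is bi-class-closing if and only if $[x]^l=[x]^r$ for all $x\in X$.
   Context: Shift spaces are closed shift-invariant subsets of $\mathcal{A}^{\mathbb{Z}}$ for a finite alphabet $\mathcal{A}$; $\mathcal{B}(X)$ is the set of words occurring in points of $X$; $X$ is irreducible if for all $u,v\in\mathcal{B}(X)$ there is $w$ with $uwv\in\mathcal{B}(X)$. $X$ is a shift of finite type if for some $k\ge 0$ every $w\in\mathcal{B}(X)$ of length $k$ satisfies: $uw,wv\in\mathcal{B}(X)$ implies $uwv\in\mathcal{B}(X)$. A factor code is a continuous shift-commuting surjection; a sofic shift is a factor of a shift of finite type. Two points $x,x'$ are left (resp. right) asymptotic if $x|_{(-\infty,n]}=x'|_{(-\infty,n]}$ (resp. $x|_{[n,\infty)}=x'|_{[n,\infty)}$) for some $n\in\mathbb{Z}$. Let $x,x'\in X$ with $\pi(x)=\pi(x')$ and $m\in\mathbb{Z}$. A right $m$-bridge from $x$ to $x'$ is a point $z\in X$ with $\pi(z)=\pi(x)$ such that for some $n>m$, $z|_{(-\infty,m]}=x|_{(-\infty,m]}$ and $z|_{[n,\infty)}=x'|_{[n,\infty)}$. A left $m$-bridge from $x$ to $x'$ is a point $z\in X$ with $\pi(z)=\pi(x)$ such that for some $n<m$, $z|_{(-\infty,n]}=x'|_{(-\infty,n]}$ and $z|_{[m,\infty)}=x|_{[m,\infty)}$.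 Write $x\to^r x'$ (resp. $x\to^l x'$) if for every $m\in\mathbb{Z}$ there is a right (resp. left) $m$-bridge from $x$ to $x'$. Points $x,x'$ in the same fibre are right equivalent if $x\to^r x'$ and $x'\to^r x$, and left equivalent if $x\to^l x'$ and $x'\to^l x$. The equivalence classes of $x$ are denoted $[x]^r$ (right class) and $[x]^l$ (left class); they are said to be over the point $\pi(x)$. $\pi$ is right (resp. left) class-closing if any two left (resp. right) asymptotic points $x,x'\in X$ with $\pi(x)=\pi(x')$ are right (resp. left) equivalent; it is bi-class-closing if it is both. Fix a metric $\rho$ on $X$ inducing the product topology. $\pi$ separates right classes if there is $\delta>0$ such that $\rho(x,x')>\delta$ for any two points $x,x'\in X$ with $\pi(x)=\pi(x')$ lying in distinct right classes. *)

theory Defs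
  imports "HOL-Analysis.Analysis"
begin

text \<open>Alphabets are finite sets \<open>A\<close> of symbols of an arbitrary type, and points are functions on
  \<^typ>\<open>int\<close>. The topology below is the product of discrete topologies; its carrier consists
  of all points with values in \<open>A\<close>.\<close>

definition full_shift :: "'a set \<Rightarrow> (int \<Rightarrow> 'a) topology" where
  "full_shift A = product_topology (\<lambda>_. discrete_topology A) UNIV"

definition shift :: "(int \<Rightarrow> 'a) \<Rightarrow> (int \<Rightarrow> 'a)" where
  "shift x = (\<lambda>i. x (i + 1))"

text \<open>Invariance is \<open>\<sigma>(X) = X\<close>; for two-sided shifts \<open>\<sigma>(X) \<subseteq> X\<close> would be a weaker condition.
  The empty shift space is allowed.\<close>

definition shift_space :: "'a set \<Rightarrow> (int \<Rightarrow> 'a) set \<Rightarrow> bool" where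
  "shift_space A X \<longleftrightarrow> finite A \<and> closedin (full_shift A) X \<and> shift ` X = X"

definition shift_language :: "(int \<Rightarrow> 'a) set \<Rightarrow> 'a list set" where
  "shift_language X = {w. \<exists>x\<in>X. \<exists>i. \<forall>j<length w. w ! j = x (i + int j)}"

definition irreducible_shift :: "(int \<Rightarrow> 'a) set \<Rightarrow> bool" where
  "irreducible_shift X \<longleftrightarrow>
     (\<forall>u\<in>shift_language X. \<forall>v\<in>shift_language X. \<exists>w. u @ w @ v \<in> shift_language X)"

definition shift_of_finite_type :: "'a set \<Rightarrow> (int \<Rightarrow> 'a) set \<Rightarrow> bool" where
  "shift_of_finite_type A X \<longleftrightarrow> shift_space A X \<and>
     (\<exists>k::nat. \<forall>w\<in>shift_language X. length w = k \<longrightarrow>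
        (\<forall>u v. u @ w \<in> shift_language X \<and> w @ v \<in> shift_language X
                \<longrightarrow> u @ w @ v \<in> shift_language X))"

text \<open>A code is represented by a function on all of \<^typ>\<open>int \<Rightarrow> 'a\<close>, of which only the values
  on \<open>X\<close> matter.\<close>

definition factor_code ::
  "'a set \<Rightarrow> (int \<Rightarrow> 'a) set \<Rightarrow> 'b set \<Rightarrow> (int \<Rightarrow> 'b) set \<Rightarrow> ((int \<Rightarrow> 'a) \<Rightarrow> (int \<Rightarrow> 'b)) \<Rightarrow> bool" where
  "factor_code A X B Y \<pi> \<longleftrightarrow>
     continuous_map (subtopology (full_shift A) X) (subtopology (full_shift B) Y) \<pi> \<and>
     (\<forall>x\<in>X. \<pi> (shift x) = shift (\<pi> x)) \<and> \<pi> ` X = Y"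

text \<open>Every finite alphabet can be renamed into the natural numbers, so letting the covering shift
  of finite type range over alphabets \<open>C :: nat set\<close> loses no generality.\<close>

definition sofic_shift :: "'b set \<Rightarrow> (int \<Rightarrow> 'b) set \<Rightarrow> bool" where
  "sofic_shift B Y \<longleftrightarrow> shift_space B Y \<and>
     (\<exists>(C :: nat set) Z \<phi>. shift_of_finite_type C Z \<and> factor_code C Z B Y \<phi>)"

definition left_asymptotic :: "(int \<Rightarrow> 'a) \<Rightarrow> (int \<Rightarrow> 'a) \<Rightarrow> bool" where
  "left_asymptotic x x' \<longleftrightarrow> (\<exists>n. \<forall>i\<le>n. x i = x' i)"

definition right_asymptotic :: "(int \<Rightarrow> 'a) \<Rightarrow> (int \<Rightarrow> 'a) \<Rightarrow> bool" where
  "right_asymptotic x x' \<longleftrightarrow> (\<exists>n. \<forall>i\<ge>n. x i = x' i)"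

definition right_bridge ::
  "(int \<Rightarrow> 'a) set \<Rightarrow> ((int \<Rightarrow> 'a) \<Rightarrow> (int \<Rightarrow> 'b)) \<Rightarrow> int \<Rightarrow>
   (int \<Rightarrow> 'a) \<Rightarrow> (int \<Rightarrow> 'a) \<Rightarrow> (int \<Rightarrow> 'a) \<Rightarrow> bool" where
  "right_bridge X \<pi> m x x' z \<longleftrightarrow> z \<in> X \<and> \<pi> z = \<pi> x \<and>
     (\<exists>n>m. (\<forall>i\<le>m. z i = x i) \<and> (\<forall>i\<ge>n. z i = x' i))"

definition left_bridge ::
  "(int \<Rightarrow> 'a) set \<Rightarrow> ((int \<Rightarrow> 'a) \<Rightarrow> (int \<Rightarrow> 'b)) \<Rightarrow> int \<Rightarrow>
   (int \<Rightarrow> 'a) \<Rightarrow> (int \<Rightarrow> 'a) \<Rightarrow> (int \<Rightarrow> 'a) \<Rightarrow> bool" where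
  "left_bridge X \<pi> m x x' z \<longleftrightarrow> z \<in> X \<and> \<pi> z = \<pi> x \<and>
     (\<exists>n<m. (\<forall>i\<le>n. z i = x' i) \<and> (\<forall>i\<ge>m. z i = x i))"

definition right_reach ::
  "(int \<Rightarrow> 'a) set \<Rightarrow> ((int \<Rightarrow> 'a) \<Rightarrow> (int \<Rightarrow> 'b)) \<Rightarrow> (int \<Rightarrow> 'a) \<Rightarrow> (int \<Rightarrow> 'a) \<Rightarrow> bool" where
  "right_reach X \<pi> x x' \<longleftrightarrow> (\<forall>m. \<exists>z. right_bridge X \<pi> m x x' z)"

definition left_reach ::
  "(int \<Rightarrow> 'a) set \<Rightarrow> ((int \<Rightarrow> 'a) \<Rightarrow> (int \<Rightarrow> 'b)) \<Rightarrow> (int \<Rightarrow> 'a) \<Rightarrow> (int \<Rightarrow> 'a) \<Rightarrow> bool" where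
  "left_reach X \<pi> x x' \<longleftrightarrow> (\<forall>m. \<exists>z. left_bridge X \<pi> m x x' z)"

definition right_equivalent ::
  "(int \<Rightarrow> 'a) set \<Rightarrow> ((int \<Rightarrow> 'a) \<Rightarrow> (int \<Rightarrow> 'b)) \<Rightarrow> (int \<Rightarrow> 'a) \<Rightarrow> (int \<Rightarrow> 'a) \<Rightarrow> bool" where
  "right_equivalent X \<pi> x x' \<longleftrightarrow>
     x \<in> X \<and> x' \<in> X \<and> \<pi> x = \<pi> x' \<and> right_reach X \<pi> x x' \<and> right_reach X \<pi> x' x"

definition left_equivalent ::
  "(int \<Rightarrow> 'a) set \<Rightarrow> ((int \<Rightarrow> 'a) \<Rightarrow> (int \<Rightarrow> 'b)) \<Rightarrow> (int \<Rightarrow> 'a) \<Rightarrow> (int \<Rightarrow> 'a) \<Rightarrow> bool" where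
  "left_equivalent X \<pi> x x' \<longleftrightarrow>
     x \<in> X \<and> x' \<in> X \<and> \<pi> x = \<pi> x' \<and> left_reach X \<pi> x x' \<and> left_reach X \<pi> x' x"

definition right_class ::
  "(int \<Rightarrow> 'a) set \<Rightarrow> ((int \<Rightarrow> 'a) \<Rightarrow> (int \<Rightarrow> 'b)) \<Rightarrow> (int \<Rightarrow> 'a) \<Rightarrow> (int \<Rightarrow> 'a) set" where
  "right_class X \<pi> x = {x'. right_equivalent X \<pi> x x'}"

definition left_class ::
  "(int \<Rightarrow> 'a) set \<Rightarrow> ((int \<Rightarrow> 'a) \<Rightarrow> (int \<Rightarrow> 'b)) \<Rightarrow> (int \<Rightarrow> 'a) \<Rightarrow> (int \<Rightarrow> 'a) set" where
  "left_class X \<pi> x = {x'. left_equivalent X \<pi> x x'}"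

definition right_class_closing ::
  "(int \<Rightarrow> 'a) set \<Rightarrow> ((int \<Rightarrow> 'a) \<Rightarrow> (int \<Rightarrow> 'b)) \<Rightarrow> bool" where
  "right_class_closing X \<pi> \<longleftrightarrow>
     (\<forall>x\<in>X. \<forall>x'\<in>X. left_asymptotic x x' \<and> \<pi> x = \<pi> x' \<longrightarrow> right_equivalent X \<pi> x x')"

definition left_class_closing ::
  "(int \<Rightarrow> 'a) set \<Rightarrow> ((int \<Rightarrow> 'a) \<Rightarrow> (int \<Rightarrow> 'b)) \<Rightarrow> bool" where
  "left_class_closing X \<pi> \<longleftrightarrow>
     (\<forall>x\<in>X. \<forall>x'\<in>X. right_asymptotic x x' \<and> \<pi> x = \<pi> x' \<longrightarrow> left_equivalent X \<pi> x x')"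

definition bi_class_closing ::
  "(int \<Rightarrow> 'a) set \<Rightarrow> ((int \<Rightarrow> 'a) \<Rightarrow> (int \<Rightarrow> 'b)) \<Rightarrow> bool" where
  "bi_class_closing X \<pi> \<longleftrightarrow> right_class_closing X \<pi> \<and> left_class_closing X \<pi>"

definition separates_right_classes ::
  "((int \<Rightarrow> 'a) \<Rightarrow> (int \<Rightarrow> 'a) \<Rightarrow> real) \<Rightarrow> (int \<Rightarrow> 'a) set \<Rightarrow>
   ((int \<Rightarrow> 'a) \<Rightarrow> (int \<Rightarrow> 'b)) \<Rightarrow> bool" where
  "separates_right_classes \<rho> X \<pi> \<longleftrightarrow>
     (\<exists>\<delta>>0. \<forall>x\<in>X. \<forall>x'\<in>X.
        \<pi> x = \<pi> x' \<and> right_class X \<pi> x \<noteq> right_class X \<pi> x' \<longrightarrow> \<rho> x x' > \<delta>)"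

end

theory Submission
  imports Defs
begin

text \<open>
  Everything rests on splicing inside a fibre. The shift \<open>X\<close> has a finite memory and, by compactness
  (Curtis, Hedlund and Lyndon), \<open>\<pi>\<close> is a sliding block code. Hence there is a length \<open>K\<close> such that
  two points of one fibre that agree on some \<open>K\<close> consecutive coordinates can be spliced there, and
  the spliced point lies in the same fibre (\<open>fibre_splicing\<close>). Splicing two bridges
  makes \<open>\<rightarrow>\<^sup>r\<close> and \<open>\<rightarrow>\<^sup>l\<close> transitive. Moreover, right asymptotic points of a fibre are right
  equivalent, since each point is itself a bridge to the other, and likewise on the left.

  The equivalences follow. If \<open>\<pi>\<close> is right class-closing and \<open>x \<sim>\<^sup>l x'\<close>, a left bridge between
  \<open>x\<close> and \<open>x'\<close> is left asymptotic to one of them and right asymptotic to the other, hence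
  right equivalent to both. Conversely, if left classes are contained in right classes, left
  asymptotic points of a fibre are left equivalent, hence right equivalent.

  As \<open>X\<close> is compact, closeness for \<open>\<rho>\<close> amounts to agreement on a long central block.
  If \<open>\<pi>\<close> is right class-closing and \<open>x\<close>, \<open>x'\<close> agree on \<open>K\<close> consecutive coordinates, the point
  that follows \<open>x\<close> and then \<open>x'\<close> is left asymptotic to \<open>x\<close> and right asymptotic to \<open>x'\<close>,
  so \<open>x\<close> and \<open>x'\<close> are right equivalent: right classes are separated. Conversely, left asymptotic points
  agree on a long central block after a translation, and right equivalence is invariant under
  translation.
\<close>

section \<open>Central blocks and the topology of a shift space\<close>

definition central_agree :: "nat \<Rightarrow> (int \<Rightarrow> 'a) \<Rightarrow> (int \<Rightarrow> 'a) \<Rightarrow> bool" where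
  "central_agree n x y \<longleftrightarrow> (\<forall>i. \<bar>i\<bar> \<le> int n \<longrightarrow> x i = y i)"

lemma central_agree_mono: "central_agree n x y \<Longrightarrow> m \<le> n \<Longrightarrow> central_agree m x y"
  unfolding central_agree_def by auto

lemma topspace_full_shift: "topspace (full_shift A) = {x. \<forall>i. x i \<in> A}"
  by (auto simp: full_shift_def PiE_def Pi_def)

lemma openin_central_agree:
  assumes "X \<subseteq> topspace (full_shift A)"
  shows "openin (subtopology (full_shift A) X) {y\<in>X. central_agree n x y}"
proof -
  define U where "U i = (if \<bar>i\<bar> \<le> int n then {x i} \<inter> A else A)" for i
  have "finite {i. \<bar>i\<bar> \<le> int n}"
    by (rule finite_subset[of _ "{- int n..int n}"]) auto
  then have "finite {i \<in> UNIV. U i \<noteq> topspace (discrete_topology A)}"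
    by (rule rev_finite_subset) (auto simp: U_def)
  then have "openin (full_shift A) (Pi\<^sub>E UNIV U)"
    unfolding full_shift_def by (subst openin_PiE_gen) (auto simp: U_def)
  moreover have "{y\<in>X. central_agree n x y} = Pi\<^sub>E UNIV U \<inter> X"
    using assms
    by (auto simp: topspace_full_shift central_agree_def U_def PiE_def Pi_def split: if_splits)
  ultimately show ?thesis
    by (auto simp: openin_subtopology)
qed

lemma central_agree_nbhd:
  assumes "openin (full_shift A) U" and "x \<in> U"
  obtains n where "\<And>y. y \<in> topspace (full_shift A) \<Longrightarrow> central_agree n x y \<Longrightarrow> y \<in> U"
proof -
  obtain V where fin: "finite {i. V i \<noteq> A}" and V: "x \<in> Pi\<^sub>E UNIV V" "Pi\<^sub>E UNIV V \<subseteq> U"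
    using assms unfolding full_shift_def openin_product_topology_alt by fastforce
  from fin have "finite ((\<lambda>i. nat \<bar>i\<bar>) ` {i. V i \<noteq> A})" by simp
  then obtain n where n: "\<And>i. V i \<noteq> A \<Longrightarrow> nat \<bar>i\<bar> \<le> n"
    unfolding finite_nat_set_iff_bounded_le by auto
  have "y \<in> U" if "y \<in> topspace (full_shift A)" "central_agree n x y" for y
  proof -
    have "y i \<in> V i" for i
    proof (cases "V i = A")
      case True
      then show ?thesis using that(1) by (simp add: topspace_full_shift)
    next
      case False
      then have "x i = y i" using n[of i] that(2) by (simp add: central_agree_def)
      then show ?thesis using V(1) by (metis PiE_mem UNIV_I)
    qed
    then show ?thesis using V(2) by (auto simp: PiE_def)
  qed
  then show thesis using that by blast
qed

lemma shift_space_subset: "shift_space A X \<Longrightarrow> X \<subseteq> topspace (full_shift A)"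
  unfolding shift_space_def by (blast dest: closedin_subset)

lemma compactin_shift_space:
  assumes "shift_space A X"
  shows "compactin (full_shift A) X"
proof -
  have "compact_space (full_shift A)"
    using assms
    by (simp add: full_shift_def shift_space_def compact_space_product_topology
        compact_space_discrete_topology)
  then show ?thesis
    using assms closedin_compact_space unfolding shift_space_def by blast
qed

text \<open>Compactness as a Lebesgue number property, with central blocks in place of small balls. It
  yields both the sliding block representation of a code and the uniform comparison of a metric
  with central blocks.\<close>

lemma central_block_Lebesgue:
  assumes X: "shift_space A X"
    and U: "\<And>c. c \<in> X \<Longrightarrow> openin (subtopology (full_shift A) X) (U c) \<and> c \<in> U c"
  shows "\<exists>n. \<forall>x\<in>X. \<exists>c\<in>X. {y\<in>X. central_agree n x y} \<subseteq> U c"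
proof -
  have "\<exists>n. {y\<in>X. central_agree n c y} \<subseteq> U c" if "c \<in> X" for c
  proof -
    note Uc = U[OF that]
    then obtain T where T: "openin (full_shift A) T" "U c = T \<inter> X"
      by (auto simp: openin_subtopology)
    then obtain n where "\<And>y. y \<in> topspace (full_shift A) \<Longrightarrow> central_agree n c y \<Longrightarrow> y \<in> T"
      using central_agree_nbhd[of A T c] Uc by (metis IntD1)
    then show ?thesis
      using T shift_space_subset[OF X] by blast
  qed
  then obtain r where r: "\<And>c. c \<in> X \<Longrightarrow> {y\<in>X. central_agree (r c) c y} \<subseteq> U c"
    by metis
  define C where "C c = {y\<in>X. central_agree (r c) c y}" for c
  have "compactin (subtopology (full_shift A) X) X"
    using compactin_shift_space[OF X] by (simp add: compactin_subtopology)
  moreover have "\<forall>T\<in>C ` X. openin (subtopology (full_shift A) X) T"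
    using openin_central_agree[OF shift_space_subset[OF X]] by (auto simp: C_def)
  moreover have "X \<subseteq> \<Union> (C ` X)"
    by (auto simp: C_def central_agree_def)
  ultimately have "\<exists>\<F>. finite \<F> \<and> \<F> \<subseteq> C ` X \<and> X \<subseteq> \<Union> \<F>"
    unfolding compactin_def by blast
  then obtain D where D: "finite D" "D \<subseteq> X" "X \<subseteq> \<Union> (C ` D)"
    by (metis finite_subset_image)
  obtain n where n: "\<And>c. c \<in> D \<Longrightarrow> r c \<le> n"
    using D(1) by (metis finite_imageI finite_nat_set_iff_bounded_le imageI)
  have "\<exists>c\<in>X. {y\<in>X. central_agree n x y} \<subseteq> U c" if "x \<in> X" for x
  proof -
    obtain c where c: "c \<in> D" "central_agree (r c) c x"
      using D(3) \<open>x \<in> X\<close> by (auto simp: C_def)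
    have "central_agree (r c) c y" if "central_agree n x y" for y
      using c(2) central_agree_mono[OF that n[OF c(1)]] by (simp add: central_agree_def)
    then show ?thesis
      using r[of c] c(1) D(2) by blast
  qed
  then show ?thesis by blast
qed

section \<open>Translations\<close>

definition translate :: "int \<Rightarrow> (int \<Rightarrow> 'a) \<Rightarrow> int \<Rightarrow> 'a" where
  "translate t x = (\<lambda>i. x (i + t))"

lemma translate_0: "translate 0 x = x"
  by (simp add: translate_def)

lemma translate_translate: "translate s (translate t x) = translate (s + t) x"
  by (simp add: translate_def algebra_simps)

lemma translate_Suc: "translate (t + 1) x = shift (translate t x)"
  by (simp add: translate_def shift_def algebra_simps)

lemma translate_commute_on_shift_space:
  assumes X: "shift_space A X" and \<pi>: "\<And>x. x \<in> X \<Longrightarrow> \<pi> (shift x) = shift (\<pi> x)"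
    and "x \<in> X"
  shows "translate t x \<in> X \<and> \<pi> (translate t x) = translate t (\<pi> x)"
proof (induction t rule: int_induct[where k = 0])
  case base
  then show ?case using \<open>x \<in> X\<close> by (simp add: translate_0)
next
  case (step1 i)
  have "shift (translate i x) \<in> X"
    using step1 X by (auto simp: shift_space_def)
  then show ?case
    using step1 \<pi>[of "translate i x"] by (simp add: translate_Suc)
next
  case (step2 i)
  obtain y where y: "y \<in> X" "shift y = translate i x"
    using step2 X unfolding shift_space_def by (metis imageE)
  have "y = translate (i - 1) x"
    using arg_cong[OF y(2), of "translate (-1)"]
    by (simp add: translate_def shift_def algebra_simps)
  moreover have "\<pi> y = translate (i - 1) (\<pi> x)"
    using arg_cong[OF \<pi>[OF y(1), symmetric], of "translate (-1)"] y(2) step2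
    by (simp add: translate_def shift_def algebra_simps)
  ultimately show ?case using y(1) by simp
qed

lemma translate_mem: "shift_space A X \<Longrightarrow> x \<in> X \<Longrightarrow> translate t x \<in> X"
  using translate_commute_on_shift_space[of A X "\<lambda>x. x"] by blast

section \<open>Splicing points of a shift of finite type\<close>

definition block :: "(int \<Rightarrow> 'a) \<Rightarrow> int \<Rightarrow> nat \<Rightarrow> 'a list" where
  "block x a n = map (\<lambda>j. x (a + int j)) [0..<n]"

lemma block_in_language: "x \<in> X \<Longrightarrow> block x a n \<in> shift_language X"
  by (auto simp: shift_language_def block_def)

lemma block_append: "block x a (m + n) = block x a m @ block x (a + int m) n"
  by (rule nth_equalityI) (auto simp: block_def nth_append)

lemma block_cong: "(\<And>i. a \<le> i \<Longrightarrow> i < a + int n \<Longrightarrow> x i = y i) \<Longrightarrow> block x a n = block y a n"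
  by (simp add: block_def)

lemma mem_shift_space_if_central_blocks:
  assumes X: "shift_space A X"
    and z: "\<And>n. \<exists>m>n. block z (- int m) (2 * m) \<in> shift_language X"
  shows "z \<in> X"
proof (rule ccontr)
  assume "z \<notin> X"
  have approx: "\<exists>y\<in>X. central_agree n z y" for n
  proof -
    obtain m where m: "m > n" "block z (- int m) (2 * m) \<in> shift_language X"
      using z by blast
    then obtain x a where x: "x \<in> X" "\<And>j. j < 2 * m \<Longrightarrow> z (int j - int m) = x (a + int j)"
      by (auto simp: shift_language_def block_def)
    have "central_agree n z (translate (a + int m) x)"
      unfolding central_agree_def translate_def
    proof (intro allI impI)
      fix i :: int assume "\<bar>i\<bar> \<le> int n"
      then have "int (nat (i + int m)) = i + int m" "nat (i + int m) < 2 * m"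
        using m(1) by linarith+
      then show "z i = x (i + (a + int m))"
        using x(2)[of "nat (i + int m)"] by (simp add: algebra_simps)
    qed
    then show ?thesis using translate_mem[OF X x(1)] by blast
  qed
  have "z \<in> topspace (full_shift A)"
    unfolding topspace_full_shift
  proof (intro CollectI allI)
    fix i
    obtain y where "y \<in> X" "central_agree (nat \<bar>i\<bar>) z y" using approx by blast
    then show "z i \<in> A"
      using shift_space_subset[OF X] by (auto simp: central_agree_def topspace_full_shift)
  qed
  moreover have "openin (full_shift A) (topspace (full_shift A) - X)"
    using X by (simp add: shift_space_def closedin_def)
  ultimately obtain n where
    "\<And>y. y \<in> topspace (full_shift A) \<Longrightarrow> central_agree n z y \<Longrightarrow> y \<in> topspace (full_shift A) - X"
    using \<open>z \<notin> X\<close> central_agree_nbhd by (metis DiffI)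
  with approx[of n] shift_space_subset[OF X] show False by blast
qed

lemma sft_splicing:
  assumes "shift_of_finite_type A X"
  obtains k where "\<And>u v a. u \<in> X \<Longrightarrow> v \<in> X \<Longrightarrow> (\<And>i. a \<le> i \<Longrightarrow> i < a + int k \<Longrightarrow> u i = v i) \<Longrightarrow>
    (\<lambda>i. if i < a then u i else v i) \<in> X"
proof -
  obtain k where X: "shift_space A X"
    and k: "\<And>w u v. w \<in> shift_language X \<Longrightarrow> length w = k \<Longrightarrow> u @ w \<in> shift_language X \<Longrightarrow>
      w @ v \<in> shift_language X \<Longrightarrow> u @ w @ v \<in> shift_language X"
    using assms unfolding shift_of_finite_type_def by blast
  have "(\<lambda>i. if i < a then u i else v i) \<in> X"
    if u: "u \<in> X" and v: "v \<in> X" and uv: "\<And>i. a \<le> i \<Longrightarrow> i < a + int k \<Longrightarrow> u i = v i" for u v a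
  proof (rule mem_shift_space_if_central_blocks[OF X])
    fix n :: nat
    let ?z = "\<lambda>i. if i < a then u i else v i"
    \<comment> \<open>The central block must contain the overlap \<open>{a..<a + k}\<close>; \<open>p\<close> and \<open>q\<close> are the lengths of its
      parts before and after the overlap.\<close>
    define m where "m = Suc n + nat \<bar>a\<bar> + k"
    define p where "p = nat (a + int m)"
    define q where "q = nat (int m - a - int k)"
    have p: "- int m + int p = a" by (simp add: p_def m_def) linarith
    have pq: "2 * m = p + (k + q)" by (simp add: p_def q_def m_def)
    have w: "block u a k = block v a k" using uv by (intro block_cong) auto
    have "block ?z (- int m) (2 * m)
        = block ?z (- int m) p @ block ?z a k @ block ?z (a + int k) q"
      by (simp only: pq block_append p)
    also have "\<dots> = block u (- int m) p @ block u a k @ block v (a + int k) q"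
      using p uv by (intro arg_cong2[of _ _ _ _ "(@)"] block_cong) auto
    also have "\<dots> \<in> shift_language X"
    proof (rule k)
      show "block u a k \<in> shift_language X" using u by (rule block_in_language)
      show "length (block u a k) = k" by (simp add: block_def)
      show "block u (- int m) p @ block u a k \<in> shift_language X"
        using block_in_language[OF u, of "- int m" "p + k"] by (simp only: block_append p)
      show "block u a k @ block v (a + int k) q \<in> shift_language X"
        using block_in_language[OF v, of a "k + q"] by (simp add: block_append w)
    qed
    finally show "\<exists>m>n. block ?z (- int m) (2 * m) \<in> shift_language X"
      by (intro exI[of _ m]) (simp add: m_def)
  qed
  then show thesis using that by blast
qed

section \<open>Factor codes of shifts of finite type\<close>

locale sft_factor =
  fixes A :: "'a set" and X :: "(int \<Rightarrow> 'a) set" and B :: "'b set" and Y :: "(int \<Rightarrow> 'b) set"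
    and \<pi> :: "(int \<Rightarrow> 'a) \<Rightarrow> (int \<Rightarrow> 'b)"
  assumes sft: "shift_of_finite_type A X" and code: "factor_code A X B Y \<pi>"
begin

lemma shift_space: "shift_space A X"
  using sft by (simp add: shift_of_finite_type_def)

lemma translate_in: "x \<in> X \<Longrightarrow> translate t x \<in> X"
  and code_translate: "x \<in> X \<Longrightarrow> \<pi> (translate t x) = translate t (\<pi> x)"
  using translate_commute_on_shift_space[OF shift_space] code by (auto simp: factor_code_def)

text \<open>The map \<open>x \<mapsto> \<pi> x 0\<close> is locally constant, hence by compactness determined by a central block of
  fixed size; the other coordinates follow by translation.\<close>

lemma sliding_block_code:
  obtains N where
    "\<And>x y i. x \<in> X \<Longrightarrow> y \<in> X \<Longrightarrow> (\<And>j. \<bar>j - i\<bar> \<le> int N \<Longrightarrow> x j = y j) \<Longrightarrow> \<pi> x i = \<pi> y i"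
proof -
  define U where "U c = {y\<in>X. \<pi> y 0 = \<pi> c 0}" for c
  have U: "openin (subtopology (full_shift A) X) (U c) \<and> c \<in> U c" if "c \<in> X" for c
  proof -
    have cont: "continuous_map (subtopology (full_shift A) X) (full_shift B) \<pi>"
      using code by (auto simp: factor_code_def continuous_map_in_subtopology)
    then have cont0: "continuous_map (subtopology (full_shift A) X) (discrete_topology B) (\<lambda>x. \<pi> x 0)"
      unfolding full_shift_def[of B] continuous_map_componentwise_UNIV by blast
    have XA: "topspace (subtopology (full_shift A) X) = X"
      using shift_space_subset[OF shift_space] by (simp add: Int_absorb1)
    have "\<pi> c 0 \<in> B"
      using continuous_map_image_subset_topspace[OF cont] that XA
      by (auto simp: topspace_full_shift)
    then have "openin (subtopology (full_shift A) X) {x \<in> X. \<pi> x 0 \<in> {\<pi> c 0}}"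
      using openin_continuous_map_preimage[OF cont0, of "{\<pi> c 0}"] unfolding XA by simp
    then show ?thesis using that by (simp add: U_def)
  qed
  obtain N where N: "\<forall>x\<in>X. \<exists>c\<in>X. {y\<in>X. central_agree N x y} \<subseteq> U c"
    using central_block_Lebesgue[of A X U, OF shift_space U] ..
  have N0: "\<pi> x 0 = \<pi> y 0" if xy: "x \<in> X" "y \<in> X" "central_agree N x y" for x y
  proof -
    obtain c where "{y\<in>X. central_agree N x y} \<subseteq> U c" using N xy(1) by blast
    moreover have "central_agree N x x" by (simp add: central_agree_def)
    ultimately have "x \<in> U c" "y \<in> U c" using xy by blast+
    then show ?thesis by (simp add: U_def)
  qed
  have "\<pi> x i = \<pi> y i"
    if "x \<in> X" "y \<in> X" and "\<And>j. \<bar>j - i\<bar> \<le> int N \<Longrightarrow> x j = y j" for x y i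
  proof -
    have "central_agree N (translate i x) (translate i y)"
      using that(3) by (simp add: central_agree_def translate_def)
    from N0[OF translate_in translate_in this] that(1,2) show ?thesis
      by (simp add: code_translate) (simp add: translate_def)
  qed
  then show thesis using that by blast
qed

lemma fibre_splicing:
  obtains K where "\<And>u v a. u \<in> X \<Longrightarrow> v \<in> X \<Longrightarrow> \<pi> u = \<pi> v \<Longrightarrow>
    (\<And>i. a \<le> i \<Longrightarrow> i < a + int K \<Longrightarrow> u i = v i) \<Longrightarrow>
    (\<lambda>i. if i < a then u i else v i) \<in> X \<and> \<pi> (\<lambda>i. if i < a then u i else v i) = \<pi> u"
proof -
  obtain k where k: "\<And>u v a. u \<in> X \<Longrightarrow> v \<in> X \<Longrightarrow> (\<And>i. a \<le> i \<Longrightarrow> i < a + int k \<Longrightarrow> u i = v i) \<Longrightarrow>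
    (\<lambda>i. if i < a then u i else v i) \<in> X"
    using sft_splicing[OF sft] by blast
  obtain N where N: "\<And>x y i. x \<in> X \<Longrightarrow> y \<in> X \<Longrightarrow> (\<And>j. \<bar>j - i\<bar> \<le> int N \<Longrightarrow> x j = y j) \<Longrightarrow>
    \<pi> x i = \<pi> y i"
    using sliding_block_code by blast
  \<comment> \<open>The overlap must allow for the memory of \<open>X\<close> and for a full window of the block code: then
    each window of the spliced point is a window of \<open>u\<close> or one of \<open>v\<close>.\<close>
  define K where "K = k + (2 * N + 1)"
  have "(\<lambda>i. if i < a then u i else v i) \<in> X \<and> \<pi> (\<lambda>i. if i < a then u i else v i) = \<pi> u"
    if uv: "u \<in> X" "v \<in> X" "\<pi> u = \<pi> v" and eq: "\<And>i. a \<le> i \<Longrightarrow> i < a + int K \<Longrightarrow> u i = v i" for u v a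
  proof -
    let ?z = "\<lambda>i. if i < a then u i else v i"
    have z: "?z \<in> X" using uv eq by (intro k) (auto simp: K_def)
    have "\<pi> ?z i = \<pi> u i" for i
    proof (cases "i \<le> a + int N")
      case True
      then show ?thesis using uv z eq by (intro N) (auto simp: K_def)
    next
      case False
      then have "\<pi> ?z i = \<pi> v i" using uv z by (intro N) auto
      then show ?thesis using uv(3) by simp
    qed
    then show ?thesis using z by blast
  qed
  then show thesis using that by blast
qed

section \<open>Right and left equivalence\<close>

text \<open>A bridge from \<open>x\<close> to \<open>x'\<close> that has joined \<open>x'\<close> by the coordinate \<open>n\<close> is spliced with a right
  \<open>(n + K)\<close>-bridge from \<open>x'\<close> to \<open>x''\<close>: both coincide with \<open>x'\<close> on the \<open>K\<close> coordinates from \<open>n\<close> on.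
  The lemma after this one is the mirror image.\<close>

lemma right_reach_trans:
  assumes "right_reach X \<pi> x x'" and "right_reach X \<pi> x' x''" and "\<pi> x = \<pi> x'"
  shows "right_reach X \<pi> x x''"
  unfolding right_reach_def
proof
  fix m
  obtain K where K: "\<And>u v a. u \<in> X \<Longrightarrow> v \<in> X \<Longrightarrow> \<pi> u = \<pi> v \<Longrightarrow>
      (\<And>i. a \<le> i \<Longrightarrow> i < a + int K \<Longrightarrow> u i = v i) \<Longrightarrow>
      (\<lambda>i. if i < a then u i else v i) \<in> X \<and> \<pi> (\<lambda>i. if i < a then u i else v i) = \<pi> u"
    using fibre_splicing by blast
  obtain z n where z: "z \<in> X" "\<pi> z = \<pi> x" "n > m" "\<And>i. i \<le> m \<Longrightarrow> z i = x i" "\<And>i. i \<ge> n \<Longrightarrow> z i = x' i"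
    using assms(1) unfolding right_reach_def right_bridge_def by metis
  obtain w l where w: "w \<in> X" "\<pi> w = \<pi> x'" "l > n + int K" "\<And>i. i \<le> n + int K \<Longrightarrow> w i = x' i"
      "\<And>i. i \<ge> l \<Longrightarrow> w i = x'' i"
    using assms(2) unfolding right_reach_def right_bridge_def by metis
  let ?t = "\<lambda>i. if i < n then z i else w i"
  have "?t \<in> X \<and> \<pi> ?t = \<pi> z"
    using z w assms(3) by (intro K) auto
  then have "right_bridge X \<pi> m x x'' ?t"
    unfolding right_bridge_def using z w by (intro conjI exI[of _ l]) auto
  then show "\<exists>z. right_bridge X \<pi> m x x'' z" by blast
qed

lemma left_reach_trans:
  assumes "left_reach X \<pi> x x'" and "left_reach X \<pi> x' x''" and "\<pi> x = \<pi> x'"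
  shows "left_reach X \<pi> x x''"
  unfolding left_reach_def
proof
  fix m
  obtain K where K: "\<And>u v a. u \<in> X \<Longrightarrow> v \<in> X \<Longrightarrow> \<pi> u = \<pi> v \<Longrightarrow>
      (\<And>i. a \<le> i \<Longrightarrow> i < a + int K \<Longrightarrow> u i = v i) \<Longrightarrow>
      (\<lambda>i. if i < a then u i else v i) \<in> X \<and> \<pi> (\<lambda>i. if i < a then u i else v i) = \<pi> u"
    using fibre_splicing by blast
  obtain z n where z: "z \<in> X" "\<pi> z = \<pi> x" "n < m" "\<And>i. i \<le> n \<Longrightarrow> z i = x' i" "\<And>i. i \<ge> m \<Longrightarrow> z i = x i"
    using assms(1) unfolding left_reach_def left_bridge_def by metis
  obtain w l where w: "w \<in> X" "\<pi> w = \<pi> x'" "l < n - int K" "\<And>i. i \<le> l \<Longrightarrow> w i = x'' i"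
      "\<And>i. i \<ge> n - int K \<Longrightarrow> w i = x' i"
    using assms(2) unfolding left_reach_def left_bridge_def by metis
  let ?t = "\<lambda>i. if i < n - int K then w i else z i"
  have "?t \<in> X \<and> \<pi> ?t = \<pi> w"
    using z w assms(3) by (intro K) auto
  then have "left_bridge X \<pi> m x x'' ?t"
    unfolding left_bridge_def using z w assms(3) by (intro conjI exI[of _ l]) auto
  then show "\<exists>z. left_bridge X \<pi> m x x'' z" by blast
qed

lemma right_equivalent_sym: "right_equivalent X \<pi> x x' \<Longrightarrow> right_equivalent X \<pi> x' x"
  by (simp add: right_equivalent_def)

lemma left_equivalent_sym: "left_equivalent X \<pi> x x' \<Longrightarrow> left_equivalent X \<pi> x' x"
  by (simp add: left_equivalent_def)

lemma right_equivalent_trans: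
  "right_equivalent X \<pi> x x' \<Longrightarrow> right_equivalent X \<pi> x' x'' \<Longrightarrow> right_equivalent X \<pi> x x''"
  unfolding right_equivalent_def using right_reach_trans by (metis (no_types, lifting))

lemma left_equivalent_trans:
  "left_equivalent X \<pi> x x' \<Longrightarrow> left_equivalent X \<pi> x' x'' \<Longrightarrow> left_equivalent X \<pi> x x''"
  unfolding left_equivalent_def by (metis left_reach_trans)

text \<open>The point \<open>x\<close> itself is a right \<open>m\<close>-bridge to every point that it eventually agrees with.\<close>

lemma right_reach_if_right_asymptotic:
  assumes "x \<in> X" and "right_asymptotic x x'"
  shows "right_reach X \<pi> x x'"
  unfolding right_reach_def
proof
  fix m
  obtain n where "\<forall>i\<ge>n. x i = x' i" using assms(2) by (auto simp: right_asymptotic_def)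
  then have "right_bridge X \<pi> m x x' x"
    unfolding right_bridge_def using assms(1) by (intro conjI exI[of _ "max n (m + 1)"]) auto
  then show "\<exists>z. right_bridge X \<pi> m x x' z" by blast
qed

lemma left_reach_if_left_asymptotic:
  assumes "x \<in> X" and "left_asymptotic x x'"
  shows "left_reach X \<pi> x x'"
  unfolding left_reach_def
proof
  fix m
  obtain n where "\<forall>i\<le>n. x i = x' i" using assms(2) by (auto simp: left_asymptotic_def)
  then have "left_bridge X \<pi> m x x' x"
    unfolding left_bridge_def using assms(1) by (intro conjI exI[of _ "min n (m - 1)"]) auto
  then show "\<exists>z. left_bridge X \<pi> m x x' z" by blast
qed

lemma right_equivalent_if_right_asymptotic:
  assumes "x \<in> X" "x' \<in> X" "\<pi> x = \<pi> x'" "right_asymptotic x x'"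
  shows "right_equivalent X \<pi> x x'"
proof -
  have "right_asymptotic x' x" using assms(4) unfolding right_asymptotic_def by metis
  then show ?thesis using assms right_reach_if_right_asymptotic by (simp add: right_equivalent_def)
qed

lemma left_equivalent_if_left_asymptotic:
  assumes "x \<in> X" "x' \<in> X" "\<pi> x = \<pi> x'" "left_asymptotic x x'"
  shows "left_equivalent X \<pi> x x'"
proof -
  have "left_asymptotic x' x" using assms(4) unfolding left_asymptotic_def by metis
  then show ?thesis using assms left_reach_if_left_asymptotic by (simp add: left_equivalent_def)
qed

lemma right_class_eq_iff:
  assumes "x \<in> X" "x' \<in> X"
  shows "right_class X \<pi> x = right_class X \<pi> x' \<longleftrightarrow> right_equivalent X \<pi> x x'"
proof
  have "right_equivalent X \<pi> x' x'"
    using right_equivalent_if_right_asymptotic[of x' x'] assms by (simp add: right_asymptotic_def)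
  then show "right_equivalent X \<pi> x x'" if "right_class X \<pi> x = right_class X \<pi> x'"
    using that by (auto simp: right_class_def)
next
  assume "right_equivalent X \<pi> x x'"
  then show "right_class X \<pi> x = right_class X \<pi> x'"
    unfolding right_class_def using right_equivalent_sym right_equivalent_trans by blast
qed

lemma right_reach_translate:
  assumes "right_reach X \<pi> x x'" and "x \<in> X"
  shows "right_reach X \<pi> (translate t x) (translate t x')"
  unfolding right_reach_def
proof
  fix m
  obtain z n where z: "z \<in> X" "\<pi> z = \<pi> x" "n > m + t" "\<And>i. i \<le> m + t \<Longrightarrow> z i = x i"
      "\<And>i. i \<ge> n \<Longrightarrow> z i = x' i"
    using assms(1) unfolding right_reach_def right_bridge_def by metis
  have "right_bridge X \<pi> m (translate t x) (translate t x') (translate t z)"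
    unfolding right_bridge_def
  proof (intro conjI exI[of _ "n - t"])
    show "\<pi> (translate t z) = \<pi> (translate t x)"
      using z(1,2) assms(2) by (simp add: code_translate)
  qed (use z translate_in in \<open>auto simp: translate_def\<close>)
  then show "\<exists>z. right_bridge X \<pi> m (translate t x) (translate t x') z" by blast
qed

lemma right_equivalent_translate:
  "right_equivalent X \<pi> x x' \<Longrightarrow> right_equivalent X \<pi> (translate t x) (translate t x')"
  unfolding right_equivalent_def by (simp add: right_reach_translate translate_in code_translate)

section \<open>Characterisations of class-closing codes\<close>

lemma right_class_closingD:
  assumes "right_class_closing X \<pi>" "x \<in> X" "x' \<in> X" "\<pi> x = \<pi> x'" "left_asymptotic x x'"
  shows "right_equivalent X \<pi> x x'"
  using assms by (simp add: right_class_closing_def)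

lemma left_class_closingD:
  assumes "left_class_closing X \<pi>" "x \<in> X" "x' \<in> X" "\<pi> x = \<pi> x'" "right_asymptotic x x'"
  shows "left_equivalent X \<pi> x x'"
  using assms by (simp add: left_class_closing_def)

text \<open>For every code, asymptotic points of a fibre are equivalent on that side. Hence class-closing,
  which asks for equivalence on the opposite side, passes from asymptotic points to whole classes,
  with a bridge as the intermediate point.\<close>

lemma right_class_closing_iff_left_class_subset:
  "right_class_closing X \<pi> \<longleftrightarrow> (\<forall>x\<in>X. left_class X \<pi> x \<subseteq> right_class X \<pi> x)"
proof
  assume closing: "right_class_closing X \<pi>"
  show "\<forall>x\<in>X. left_class X \<pi> x \<subseteq> right_class X \<pi> x"
    unfolding left_class_def right_class_def
  proof clarify
    fix x x' assume "left_equivalent X \<pi> x x'"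
    then have x: "x \<in> X" "x' \<in> X" "\<pi> x = \<pi> x'" and reach: "left_reach X \<pi> x x'"
      unfolding left_equivalent_def by blast+
    from reach obtain z where "left_bridge X \<pi> 0 x x' z"
      unfolding left_reach_def by blast
    then have z: "z \<in> X" "\<pi> z = \<pi> x" "left_asymptotic z x'" "right_asymptotic x z"
      unfolding left_bridge_def left_asymptotic_def right_asymptotic_def by metis+
    have "right_equivalent X \<pi> x z"
      using x z by (intro right_equivalent_if_right_asymptotic) auto
    moreover have "right_equivalent X \<pi> z x'"
      using x z by (intro right_class_closingD[OF closing]) auto
    ultimately show "right_equivalent X \<pi> x x'" by (rule right_equivalent_trans)
  qed
next
  assume sub: "\<forall>x\<in>X. left_class X \<pi> x \<subseteq> right_class X \<pi> x"
  show "right_class_closing X \<pi>"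
    unfolding right_class_closing_def
  proof clarify
    fix x x' assume x: "x \<in> X" "x' \<in> X" "left_asymptotic x x'" "\<pi> x = \<pi> x'"
    then have "x' \<in> left_class X \<pi> x"
      unfolding left_class_def by (blast intro: left_equivalent_if_left_asymptotic)
    then have "x' \<in> right_class X \<pi> x" using sub x(1) by blast
    then show "right_equivalent X \<pi> x x'" by (simp add: right_class_def)
  qed
qed

lemma left_class_closing_iff_right_class_subset:
  "left_class_closing X \<pi> \<longleftrightarrow> (\<forall>x\<in>X. right_class X \<pi> x \<subseteq> left_class X \<pi> x)"
proof
  assume closing: "left_class_closing X \<pi>"
  show "\<forall>x\<in>X. right_class X \<pi> x \<subseteq> left_class X \<pi> x"
    unfolding left_class_def right_class_def
  proof clarify
    fix x x' assume "right_equivalent X \<pi> x x'"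
    then have x: "x \<in> X" "x' \<in> X" "\<pi> x = \<pi> x'" and reach: "right_reach X \<pi> x x'"
      unfolding right_equivalent_def by blast+
    from reach obtain z where "right_bridge X \<pi> 0 x x' z"
      unfolding right_reach_def by blast
    then have z: "z \<in> X" "\<pi> z = \<pi> x" "left_asymptotic x z" "right_asymptotic z x'"
      unfolding right_bridge_def left_asymptotic_def right_asymptotic_def by metis+
    have "left_equivalent X \<pi> x z"
      using x z by (intro left_equivalent_if_left_asymptotic) auto
    moreover have "left_equivalent X \<pi> z x'"
      using x z by (intro left_class_closingD[OF closing]) auto
    ultimately show "left_equivalent X \<pi> x x'" by (rule left_equivalent_trans)
  qed
next
  assume sub: "\<forall>x\<in>X. right_class X \<pi> x \<subseteq> left_class X \<pi> x"
  show "left_class_closing X \<pi>"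
    unfolding left_class_closing_def
  proof clarify
    fix x x' assume x: "x \<in> X" "x' \<in> X" "right_asymptotic x x'" "\<pi> x = \<pi> x'"
    then have "x' \<in> right_class X \<pi> x"
      unfolding right_class_def by (blast intro: right_equivalent_if_right_asymptotic)
    then have "x' \<in> left_class X \<pi> x" using sub x(1) by blast
    then show "left_equivalent X \<pi> x x'" by (simp add: left_class_def)
  qed
qed

lemma right_equivalent_if_agree_on_block:
  assumes "right_class_closing X \<pi>"
  obtains K where "\<And>x x'. x \<in> X \<Longrightarrow> x' \<in> X \<Longrightarrow> \<pi> x = \<pi> x' \<Longrightarrow> central_agree K x x' \<Longrightarrow>
    right_equivalent X \<pi> x x'"
proof -
  obtain K where K: "\<And>u v a. u \<in> X \<Longrightarrow> v \<in> X \<Longrightarrow> \<pi> u = \<pi> v \<Longrightarrow>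
      (\<And>i. a \<le> i \<Longrightarrow> i < a + int K \<Longrightarrow> u i = v i) \<Longrightarrow>
      (\<lambda>i. if i < a then u i else v i) \<in> X \<and> \<pi> (\<lambda>i. if i < a then u i else v i) = \<pi> u"
    using fibre_splicing by blast
  have "right_equivalent X \<pi> x x'"
    if x: "x \<in> X" "x' \<in> X" "\<pi> x = \<pi> x'" "central_agree K x x'" for x x'
  proof -
    define z where "z i = (if i < 0 then x i else x' i)" for i :: int
    have z: "z \<in> X" "\<pi> z = \<pi> x"
      using K[of x x' 0] x unfolding z_def central_agree_def by auto
    have "left_asymptotic x z"
      unfolding left_asymptotic_def z_def by (intro exI[of _ "-1"]) auto
    then have "right_equivalent X \<pi> x z"
      using x z by (intro right_class_closingD[OF assms]) auto
    moreover have "right_asymptotic z x'"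
      unfolding right_asymptotic_def z_def by (intro exI[of _ 0]) auto
    then have "right_equivalent X \<pi> z x'"
      using x z by (intro right_equivalent_if_right_asymptotic) auto
    ultimately show ?thesis by (rule right_equivalent_trans)
  qed
  then show thesis using that by blast
qed

text \<open>The metric enters only through the uniformity of the compact space \<open>X\<close>: in both
  directions a Lebesgue number converts between distances and central blocks.\<close>

lemma right_class_closing_iff_separates:
  assumes metric: "Metric_space X \<rho>"
    and top: "Metric_space.mtopology X \<rho> = subtopology (full_shift A) X"
  shows "right_class_closing X \<pi> \<longleftrightarrow> separates_right_classes \<rho> X \<pi>"
proof
  interpret Metric_space X \<rho> by (rule metric)
  assume "right_class_closing X \<pi>"
  then obtain K where K: "\<And>x x'. x \<in> X \<Longrightarrow> x' \<in> X \<Longrightarrow> \<pi> x = \<pi> x' \<Longrightarrow> central_agree K x x' \<Longrightarrow>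
      right_equivalent X \<pi> x x'"
    using right_equivalent_if_agree_on_block by metis
  define U where "U c = {y\<in>X. central_agree K c y}" for c
  have "compactin mtopology X"
    unfolding top using compactin_shift_space[OF shift_space] by (simp add: compactin_subtopology)
  moreover have "X \<subseteq> \<Union> (U ` X)"
    by (auto simp: U_def central_agree_def)
  moreover have "openin mtopology T" if "T \<in> U ` X" for T
    unfolding top using that openin_central_agree[OF shift_space_subset[OF shift_space]]
    by (auto simp: U_def)
  ultimately obtain \<epsilon> where \<epsilon>: "\<epsilon> > 0" "\<And>x. x \<in> X \<Longrightarrow> \<exists>T\<in>U ` X. mball x \<epsilon> \<subseteq> T"
    using lebesgue_number[of X "U ` X"] by metis
  have "\<rho> x x' > \<epsilon> / 2"
    if x: "x \<in> X" "x' \<in> X" "\<pi> x = \<pi> x'" "right_class X \<pi> x \<noteq> right_class X \<pi> x'" for x x'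
  proof (rule ccontr)
    assume "\<not> \<rho> x x' > \<epsilon> / 2"
    then have "x \<in> mball x \<epsilon>" "x' \<in> mball x \<epsilon>" using x \<epsilon>(1) by auto
    then obtain c where "x \<in> U c" "x' \<in> U c" using \<epsilon>(2)[OF x(1)] by blast
    then have "central_agree K x x'" by (simp add: U_def central_agree_def)
    then show False using K x right_class_eq_iff by metis
  qed
  then show "separates_right_classes \<rho> X \<pi>"
    unfolding separates_right_classes_def using \<epsilon>(1) by (intro exI[of _ "\<epsilon> / 2"]) auto
next
  interpret Metric_space X \<rho> by (rule metric)
  assume "separates_right_classes \<rho> X \<pi>"
  then obtain \<delta> where \<delta>: "\<delta> > 0" "\<And>x x'. x \<in> X \<Longrightarrow> x' \<in> X \<Longrightarrow> \<pi> x = \<pi> x' \<Longrightarrow>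
      right_class X \<pi> x \<noteq> right_class X \<pi> x' \<Longrightarrow> \<rho> x x' > \<delta>"
    unfolding separates_right_classes_def by metis
  have open_ball: "openin (subtopology (full_shift A) X) (mball c (\<delta> / 2)) \<and> c \<in> mball c (\<delta> / 2)"
    if "c \<in> X" for c
    using that \<delta>(1) openin_mball[of c "\<delta> / 2"] by (simp add: top)
  obtain N where N: "\<forall>x\<in>X. \<exists>c\<in>X. {y\<in>X. central_agree N x y} \<subseteq> mball c (\<delta> / 2)"
    using central_block_Lebesgue[of A X "\<lambda>c. mball c (\<delta> / 2)", OF shift_space open_ball] ..
  have close: "\<rho> x x' < \<delta>" if xy: "x \<in> X" "x' \<in> X" "central_agree N x x'" for x x'
  proof -
    obtain c where c: "{y\<in>X. central_agree N x y} \<subseteq> mball c (\<delta> / 2)" using N xy(1) by blast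
    moreover have "central_agree N x x" by (simp add: central_agree_def)
    ultimately have "x \<in> mball c (\<delta> / 2)" "x' \<in> mball c (\<delta> / 2)" using xy by blast+
    then show ?thesis using triangle[of x c x'] commute[of x c] by auto
  qed
  show "right_class_closing X \<pi>"
    unfolding right_class_closing_def
  proof clarify
    fix x x' assume x: "x \<in> X" "x' \<in> X" "\<pi> x = \<pi> x'" "left_asymptotic x x'"
    then obtain n where n: "\<And>i. i \<le> n \<Longrightarrow> x i = x' i" by (auto simp: left_asymptotic_def)
    \<comment> \<open>The translation carries the coordinate \<open>n\<close> to the right end \<open>N\<close> of the central block.\<close>
    define t where "t = n - int N"
    let ?y = "translate t x" and ?y' = "translate t x'"
    have y: "?y \<in> X" "?y' \<in> X" "\<pi> ?y = \<pi> ?y'" using x by (auto simp: translate_in code_translate)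
    have "central_agree N ?y ?y'" using n by (simp add: central_agree_def translate_def t_def)
    then have "right_class X \<pi> ?y = right_class X \<pi> ?y'"
      using \<delta>(2)[OF y] close[OF y(1,2)] by (metis less_asym)
    then have "right_equivalent X \<pi> ?y ?y'" using right_class_eq_iff y by blast
    then have "right_equivalent X \<pi> (translate (- t) ?y) (translate (- t) ?y')"
      by (rule right_equivalent_translate)
    then show "right_equivalent X \<pi> x x'" by (simp add: translate_translate translate_0)
  qed
qed

end

theorem corollary4p6:
  fixes A :: "'a set" and B :: "'b set"
    and X :: "(int \<Rightarrow> 'a) set" and Y :: "(int \<Rightarrow> 'b) set"
    and \<pi> :: "(int \<Rightarrow> 'a) \<Rightarrow> (int \<Rightarrow> 'b)"
    and \<rho> :: "(int \<Rightarrow> 'a) \<Rightarrow> (int \<Rightarrow> 'a) \<Rightarrow> real"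
  assumes "shift_of_finite_type A X" and "irreducible_shift X"
    and "sofic_shift B Y"
    and "factor_code A X B Y \<pi>"
    and "Metric_space X \<rho>"
    and "Metric_space.mtopology X \<rho> = subtopology (full_shift A) X"
  shows "(right_class_closing X \<pi> \<longleftrightarrow> separates_right_classes \<rho> X \<pi>) \<and>
         (separates_right_classes \<rho> X \<pi> \<longleftrightarrow> (\<forall>x\<in>X. left_class X \<pi> x \<subseteq> right_class X \<pi> x)) \<and>
         (bi_class_closing X \<pi> \<longleftrightarrow> (\<forall>x\<in>X. left_class X \<pi> x = right_class X \<pi> x))"
proof -
  interpret sft_factor A X B Y \<pi>
    by unfold_locales (fact assms)+
  show ?thesis
    using right_class_closing_iff_separates[OF assms(5,6)] right_class_closing_iff_left_class_subset
      left_class_closing_iff_right_class_subset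
    unfolding bi_class_closing_def by blast
qed

end
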